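(* Let $M,N\in\mathbb{N}$. For $g\in\ell^2(\mathbb{Z})$ consider the Gabor system $\mathcal{G}(g,M,N):=\{E_{m/M}T_{nN}g\}_{n\in\mathbb{Z},\,m=0,\dots,M-1}$. Then the following hold: (i) If $M=1$, the system $\mathcal{G}(g,M,N)$ is linearly independent for all $g\in\ell^2(\mathbb{Z})\setminus\{0\}$. (ii) If $g\in\ell^2(\mathbb{Z})$ is finitely supported and $M>|\mathrm{supp}\,g|$, then $\mathcal{G}(g,M,N)$ is linearly dependent. (iii) If $N<M$, then $\mathcal{G}(g,M,N)$ is linearly dependent for any finitely supported $g\in\ell^2(\mathbb{Z})$. (iv) For all $M,N,K\in\mathbb{N}$ there exists a linearly dependent Gabor system $\mathcal{G}(g,M,N)$ with $|\mathrm{supp}\,g|=K$. (v) If $N\ge M$, then for any $K\in\mathbb{N}$ with $K\ge M$ there exists a linearly independent Gabor system $\mathcal{G}(g,M,N)$ with $|\mathrm{supp}\,g|=K$.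
   Context: $\mathbb{N}=\{1,2,3,\dots\}$. $\ell^2(\mathbb{Z})$ is the complex Hilbert space of square-summable sequences indexed by $\mathbb{Z}$; $g(j)$ denotes the $j$th coordinate of $g\in\ell^2(\mathbb{Z})$. For $M,N\in\mathbb{N}$, $m\in\{0,\dots,M-1\}$ and $n\in\mathbb{Z}$, the modulation operator is $E_{m/M}g(j)=e^{2\pi i jm/M}g(j)$ and the translation operator is $T_n g(j)=g(j-n)$, so $E_{m/M}T_{nN}g(j)=e^{2\pi i jm/M}g(j-nN)$. For a finitely supported sequence $g$, $|\mathrm{supp}\,g|$ denotes the number of nonzero entries of $g$. Linear (in)dependence of a Gabor system refers to the indexed family over $(n,m)\in\mathbb{Z}\times\{0,\dots,M-1\}$ (repeated vectors count as dependent) and to finite complex linear combinations: the family is linearly independent if every finite linear combination equal to $0$ has all coefficients zero, and linearly dependent otherwise.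
   Formalization: Item (iv) is stated for M ≥ 2 only (all N, K in ℕ): for M = 1 it is false, since |supp g| = K ≥ 1 makes g nonzero and then G(g,1,N) is linearly independent by item (i). *)

theory Defs
  imports "HOL-Analysis.Analysis"
begin

definition ell2_Z :: "(int \<Rightarrow> complex) set" where
  "ell2_Z = {g. (\<lambda>j. (cmod (g j))\<^sup>2) summable_on UNIV}"

definition supp :: "(int \<Rightarrow> complex) \<Rightarrow> int set" where
  "supp g = {j. g j \<noteq> 0}"

definition modulation :: "real \<Rightarrow> (int \<Rightarrow> complex) \<Rightarrow> int \<Rightarrow> complex" where
  "modulation b g = (\<lambda>j. exp (2 * of_real pi * \<i> * of_int j * of_real b) * g j)"

definition translation :: "int \<Rightarrow> (int \<Rightarrow> complex) \<Rightarrow> int \<Rightarrow> complex" where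
  "translation n g = (\<lambda>j. g (j - n))"

definition gabor :: "(int \<Rightarrow> complex) \<Rightarrow> nat \<Rightarrow> nat \<Rightarrow> int \<times> nat \<Rightarrow> int \<Rightarrow> complex" where
  "gabor g M N = (\<lambda>(n, m). modulation (real m / real M) (translation (n * int N) g))"

(* Independence of an indexed family, not of its range: repeated vectors count as dependent.
   The library's independent is a predicate on sets of vectors. *)
definition lin_indep_family :: "'i set \<Rightarrow> ('i \<Rightarrow> int \<Rightarrow> complex) \<Rightarrow> bool" where
  "lin_indep_family I f \<longleftrightarrow>
     (\<forall>F c. finite F \<longrightarrow> F \<subseteq> I \<longrightarrow> (\<lambda>j. \<Sum>i\<in>F. c i * f i j) = (\<lambda>j. 0) \<longrightarrow> (\<forall>i\<in>F. c i = 0))"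

definition gabor_independent :: "(int \<Rightarrow> complex) \<Rightarrow> nat \<Rightarrow> nat \<Rightarrow> bool" where
  "gabor_independent g M N \<longleftrightarrow> lin_indep_family (UNIV \<times> {0..<M}) (gabor g M N)"

abbreviation gabor_dependent :: "(int \<Rightarrow> complex) \<Rightarrow> nat \<Rightarrow> nat \<Rightarrow> bool" where
  "gabor_dependent g M N \<equiv> \<not> gabor_independent g M N"

end

theory Submission
  imports Defs "HOL-Computational_Algebra.Fundamental_Theorem_Algebra"
begin

text \<open>
  For \<open>M = 1\<close>, a dependence is a polynomial in the shift annihilating \<open>g\<close>. Over the complex numbers it
  splits into factors \<open>S - \<lambda>\<close>, each injective on the sequences vanishing at infinity, since an
  eigenvector of the shift is geometric in both directions. The dependence claims \<open>(ii)\<close> and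
  \<open>(iii)\<close> count dimensions: the \<open>M\<close> modulations of \<open>g\<close> live on \<open>supp g\<close>, and if \<open>supp g\<close> lies in
  an interval of length \<open>L\<close>, the \<open>M (L + 1)\<close> vectors coming from \<open>L + 1\<close> translates live on
  \<open>L + L N\<close> coordinates. For \<open>(iv)\<close> a window supported in \<open>M \<int>\<close> is fixed by every modulation, and
  for \<open>(v)\<close> the indicator of \<open>K\<close> consecutive integers works: the leftmost translate is alone on its
  first \<open>M\<close> coordinates, where the discrete Fourier matrix is invertible.
\<close>

section \<open>Gabor families, supports and finite index sets\<close>

lemma gabor_apply:
  "gabor g M N (n, m) j = exp (2 * of_real pi * \<i> * of_int j * of_real (real m / real M)) * g (j - n * int N)"
  by (simp add: gabor_def modulation_def translation_def)

lemma finite_supp_in_ell2_Z: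
  assumes "finite (supp g)"
  shows "g \<in> ell2_Z"
proof -
  have "(\<lambda>j. (cmod (g j))\<^sup>2) summable_on supp g"
    using assms by simp
  then have "(\<lambda>j. (cmod (g j))\<^sup>2) summable_on UNIV"
    by (rule summable_on_cong_neutral[THEN iffD1, rotated -1]) (auto simp: supp_def)
  then show ?thesis
    by (simp add: ell2_Z_def)
qed

lemma finite_int_subset_interval:
  fixes A :: "int set"
  assumes "finite A"
  obtains a L where "A \<subseteq> {a..<a + int L}"
proof (cases "A = {}")
  case False
  have "Min A \<le> Max A"
    using assms False by simp
  then have "int (nat (Max A + 1 - Min A)) = Max A + 1 - Min A"
    by simp
  then have "A \<subseteq> {Min A..<Min A + int (nat (Max A + 1 - Min A))}"
    using assms by (auto simp: le_less_trans zless_add1_eq)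
  then show ?thesis by (rule that)
qed (use that in auto)

lemma lin_indep_familyD:
  assumes "lin_indep_family I f" "finite F" "F \<subseteq> I" "\<And>j. (\<Sum>i\<in>F. c i * f i j) = 0" "i \<in> F"
  shows "c i = 0"
  using assms unfolding lin_indep_family_def by auto

text \<open>Every finite index set sits in a rectangle, and a combination over it can be padded with
  zero coefficients. The double sum over natural numbers makes induction on the translate and
  polynomials in the shift available.\<close>

lemma gabor_independentI:
  assumes "\<And>a L d. (\<And>j. (\<Sum>k<L. \<Sum>m<M. d k m * gabor g M N (a + int k, m) j) = 0)
              \<Longrightarrow> (\<And>k m. k < L \<Longrightarrow> m < M \<Longrightarrow> d k m = 0)"
  shows "gabor_independent g M N"
  unfolding gabor_independent_def lin_indep_family_def
proof (intro allI impI ballI)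
  fix F :: "(int \<times> nat) set" and c :: "int \<times> nat \<Rightarrow> complex" and i
  assume F: "finite F" "F \<subseteq> UNIV \<times> {0..<M}" and i: "i \<in> F"
    and zero: "(\<lambda>j. \<Sum>i\<in>F. c i * gabor g M N i j) = (\<lambda>j. 0)"
  obtain a L where aL: "fst ` F \<subseteq> {a..<a + int L}"
    using finite_int_subset_interval[of "fst ` F"] F(1) by blast
  define d where "d k m = (if (a + int k, m) \<in> F then c (a + int k, m) else 0)" for k m
  let ?h = "\<lambda>(k, m). (a + int k, m) :: int \<times> nat"
  have inj: "inj_on ?h ({..<L} \<times> {..<M})"
    by (auto simp: inj_on_def)
  have sub: "F \<subseteq> ?h ` ({..<L} \<times> {..<M})"
  proof
    fix x assume x: "x \<in> F"
    obtain n m where nm: "x = (n, m)" by (cases x)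
    have "a \<le> n" "n < a + int L" "m < M"
      using x nm aL F(2) by auto
    then have "x = ?h (nat (n - a), m)" "(nat (n - a), m) \<in> {..<L} \<times> {..<M}"
      by (auto simp: nm)
    then show "x \<in> ?h ` ({..<L} \<times> {..<M})" by blast
  qed
  have "(\<Sum>k<L. \<Sum>m<M. d k m * gabor g M N (a + int k, m) j) = 0" for j
  proof -
    have "(\<Sum>k<L. \<Sum>m<M. d k m * gabor g M N (a + int k, m) j)
        = (\<Sum>x\<in>{..<L} \<times> {..<M}. (if ?h x \<in> F then c (?h x) else 0) * gabor g M N (?h x) j)"
      unfolding sum.cartesian_product by (intro sum.cong refl) (auto simp: d_def)
    also have "\<dots> = (\<Sum>x\<in>?h ` ({..<L} \<times> {..<M}). (if x \<in> F then c x else 0) * gabor g M N x j)"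
      by (subst sum.reindex[OF inj]) (simp add: o_def)
    also have "\<dots> = (\<Sum>x\<in>F. c x * gabor g M N x j)"
      using sub by (intro sum.mono_neutral_cong_right) auto
    also have "\<dots> = 0"
      using zero by (rule fun_cong)
    finally show ?thesis .
  qed
  then have d0: "d k m = 0" if "k < L" "m < M" for k m
    using assms[where a = a and L = L and d = d] that by blast
  obtain k m where "i = (a + int k, m)" "k < L" "m < M"
    using i sub by auto
  then show "c i = 0"
    using d0[of k m] i by (simp add: d_def)
qed

section \<open>Linear dependence: dimension counts and repeated vectors\<close>

lemma homogeneous_system_nontrivial_solution:
  fixes f :: "'i \<Rightarrow> 'j \<Rightarrow> 'a::field"
  assumes "finite S" "finite F" "card S < card F"
  shows "\<exists>c. (\<exists>i\<in>F. c i \<noteq> 0) \<and> (\<forall>j\<in>S. (\<Sum>i\<in>F. c i * f i j) = 0)"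
  using assms
proof (induction S arbitrary: F f rule: finite_induct)
  case empty
  then have "F \<noteq> {}" by auto
  then show ?case by (intro exI[of _ "\<lambda>_. 1"]) auto
next
  case (insert s S)
  show ?case
  proof (cases "\<forall>i\<in>F. f i s = 0")
    case True
    from insert obtain c where "\<exists>i\<in>F. c i \<noteq> 0" "\<forall>j\<in>S. (\<Sum>i\<in>F. c i * f i j) = 0"
      by (metis Suc_lessD card_insert_disjoint)
    with True show ?thesis by (intro exI[of _ c]) auto
  next
    case False
    then obtain k where k: "k \<in> F" "f k s \<noteq> 0" by blast
    \<comment> \<open>Gaussian elimination with pivot \<open>f k s\<close>: equation
      \<open>s\<close> becomes trivial for \<open>f'\<close>, at the price of one unknown.\<close>
    define f' where "f' i j = f i j - f i s / f k s * f k j" for i j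
    have "card S < card (F - {k})"
      using insert k by simp
    then obtain c where c: "\<exists>i\<in>F - {k}. c i \<noteq> 0" "\<forall>j\<in>S. (\<Sum>i\<in>F - {k}. c i * f' i j) = 0"
      using insert.IH[of "F - {k}" f'] insert.prems by auto
    \<comment> \<open>Back substitution: the multiples of \<open>f k\<close> subtracted in
      \<open>f'\<close> are collected in the coefficient at \<open>k\<close>. Elsewhere
      \<open>c'\<close> agrees with \<open>c\<close>, so it stays nontrivial.\<close>
    define c' where "c' = c(k := - (\<Sum>i\<in>F - {k}. c i * (f i s / f k s)))"
    have eq: "(\<Sum>i\<in>F. c' i * f i j) = (\<Sum>i\<in>F - {k}. c i * f' i j)" for j
    proof -
      have "(\<Sum>i\<in>F. c' i * f i j) = c' k * f k j + (\<Sum>i\<in>F - {k}. c' i * f i j)"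
        using insert.prems k by (intro sum.remove) auto
      also have "(\<Sum>i\<in>F - {k}. c' i * f i j) = (\<Sum>i\<in>F - {k}. c i * f i j)"
        by (intro sum.cong) (auto simp: c'_def)
      finally show ?thesis
        by (simp add: c'_def f'_def sum_subtractf right_diff_distrib sum_distrib_right mult.assoc)
    qed
    have "f' i s = 0" for i
      using k by (simp add: f'_def)
    then have "\<forall>j\<in>insert s S. (\<Sum>i\<in>F. c' i * f i j) = 0"
      using c(2) by (simp add: eq)
    moreover have "\<exists>i\<in>F. c' i \<noteq> 0"
      using c(1) by (auto simp: c'_def)
    ultimately show ?thesis by blast
  qed
qed

lemma not_lin_indep_family_of_small_support:
  assumes "finite F" "F \<subseteq> I" "finite S" "card S < card F"
    and "\<And>i j. i \<in> F \<Longrightarrow> j \<notin> S \<Longrightarrow> f i j = 0"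
  shows "\<not> lin_indep_family I f"
proof -
  obtain c where c: "\<exists>i\<in>F. c i \<noteq> 0" "\<forall>j\<in>S. (\<Sum>i\<in>F. c i * f i j) = 0"
    using homogeneous_system_nontrivial_solution[OF assms(3,1,4)] by blast
  have "(\<Sum>i\<in>F. c i * f i j) = 0" for j
    using c(2) assms(5) by (cases "j \<in> S") auto
  then show ?thesis
    using lin_indep_familyD[OF _ assms(1,2)] c(1) by blast
qed

lemma gabor_dependent_card_supp_less:
  assumes "finite (supp g)" "card (supp g) < M"
  shows "gabor_dependent g M N"
  unfolding gabor_independent_def
  by (rule not_lin_indep_family_of_small_support[where F = "{0} \<times> {0..<M}" and S = "supp g"])
     (use assms in \<open>auto simp: card_cartesian_product gabor_apply supp_def\<close>)

lemma gabor_dependent_oversampled: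
  assumes "finite (supp g)" "N < M"
  shows "gabor_dependent g M N"
proof -
  obtain a L where aL: "supp g \<subseteq> {a..<a + int L}"
    using finite_int_subset_interval[OF assms(1)] by blast
  \<comment> \<open>The translates by \<open>0, N, ..., L * N\<close> all live on \<open>?S\<close>.
    Since \<open>N < M\<close>, it has at most \<open>L * M\<close> points; the extra translate
    makes the inequality strict even for \<open>L = 0\<close>.\<close>
  let ?F = "{0..<int (Suc L)} \<times> {0..<M}" and ?S = "{a..<a + int (L + L * N)}"
  have "L + L * N = L * Suc N"
    by simp
  also have "\<dots> \<le> L * M"
    using assms(2) by (intro mult_le_mono2) simp
  also have "\<dots> < Suc L * M"
    using assms(2) by simp
  finally have card: "card ?S < card ?F"
    by (simp only: card_cartesian_product card_atLeastLessThan_int card_atLeastLessThan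
        add_diff_cancel_left' diff_zero nat_int)
  have "gabor g M N i j = 0" if "i \<in> ?F" "j \<notin> ?S" for i j
  proof -
    obtain n m where i: "i = (n, m)" by (cases i)
    then have "0 \<le> n * int N" "n * int N \<le> int L * int N"
      using that(1) by (auto intro: mult_right_mono)
    then have "j - n * int N \<notin> {a..<a + int L}"
      using that(2) by auto
    then show ?thesis
      using aL by (auto simp: i gabor_apply supp_def)
  qed
  then show ?thesis
    unfolding gabor_independent_def
    by (intro not_lin_indep_family_of_small_support[OF _ _ _ card]) auto
qed

text \<open>On multiples of \<open>M\<close> the modulation with \<open>m = 1\<close> is trivial, so
  the vectors at \<open>(0, 0)\<close> and \<open>(0, 1)\<close> coincide. The index
  \<open>m = 1\<close> exists only for \<open>M \<ge> 2\<close>; for \<open>M = 1\<close> and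
  \<open>N, K \<ge> 1\<close> the claim is false, as then every nonzero window in
  \<open>ell2_Z\<close> gives an independent system.\<close>

lemma exists_gabor_dependent:
  assumes "M \<ge> 2"
  shows "\<exists>g. finite (supp g) \<and> card (supp g) = K \<and> gabor_dependent g M N"
proof -
  define A where "A = (\<lambda>k. int (k * M)) ` {..<K}"
  define g :: "int \<Rightarrow> complex" where "g = indicator A"
  have supp: "supp g = A"
    by (auto simp: g_def supp_def indicator_def)
  have "inj_on (\<lambda>k. int (k * M)) {..<K}"
    using assms by (auto simp: inj_on_def)
  then have card: "card A = K"
    by (simp add: A_def card_image)
  have same: "gabor g M N (0, 1) j = gabor g M N (0, 0) j" for j
  proof (cases "j \<in> A")
    case True
    then obtain k where "j = int (k * M)"
      by (auto simp: A_def)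
    then have "2 * of_real pi * \<i> * of_int j * of_real (real 1 / real M) =
        complex_of_real (2 * real k * pi) * \<i>"
      using assms by (simp add: field_simps)
    then have "exp (2 * of_real pi * \<i> * of_int j * of_real (real 1 / real M)) = 1"
      using exp_integer_2pi[of "real k"] by simp
    then show ?thesis
      by (simp add: gabor_apply)
  qed (simp add: gabor_apply g_def)
  let ?F = "{(0, 0), (0, 1)} :: (int \<times> nat) set"
  let ?c = "\<lambda>i :: int \<times> nat. if i = (0, 0) then 1 else - 1 :: complex"
  have "gabor_dependent g M N"
  proof
    assume "gabor_independent g M N"
    then have "?c (0, 0) = 0"
      unfolding gabor_independent_def
      by (rule lin_indep_familyD[where F = ?F and c = ?c]) (use same assms in auto)
    then show False by simp
  qed
  moreover have "finite (supp g)" "card (supp g) = K"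
    using card by (simp_all add: supp A_def)
  ultimately show ?thesis by blast
qed

section \<open>Linear independence for \<open>M \<le> N\<close>\<close>

lemma discrete_Fourier_matrix_inj:
  assumes "\<And>r. r < M \<Longrightarrow> (\<Sum>m<M. a m * cis (2 * pi * real r / real M) ^ m) = 0" "m < M"
  shows "a m = 0"
proof (rule ccontr)
  assume am: "a m \<noteq> 0"
  have M: "0 < M" "m \<le> M - 1" "{..M - 1} = {..<M}"
    using assms(2) by auto
  \<comment> \<open>The hypothesis makes all \<open>M\<close> roots of unity zeros of a polynomial
    of degree at most \<open>M - 1\<close>, which is nonzero because of \<open>a m\<close>.\<close>
  let ?Z = "{z. (\<Sum>i\<le>M - 1. a i * z ^ i) = 0}"
  let ?w = "\<lambda>r. cis (2 * pi * real r / real M)"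
  have Z: "finite ?Z" "card ?Z \<le> M - 1"
    using Transcendental.polyfun_rootbound[of a m "M - 1"] am M by auto
  have "?w ` {..<M} \<subseteq> ?Z"
    unfolding M(3) using assms(1) by auto
  then have "card (?w ` {..<M}) \<le> card ?Z"
    using Z(1) by (intro card_mono)
  moreover have "inj_on ?w {..<M}"
    using Complex.bij_betw_roots_unity[OF M(1)] by (rule bij_betw_imp_inj_on)
  ultimately show False
    using Z(2) M(1) by (simp add: card_image)
qed

lemma exists_gabor_independent:
  assumes "M \<le> N" "M \<le> K"
  shows "\<exists>g. finite (supp g) \<and> card (supp g) = K \<and> gabor_independent g M N"
proof -
  define g :: "int \<Rightarrow> complex" where "g = indicator {0..<int K}"
  have supp: "supp g = {0..<int K}"
    by (auto simp: g_def supp_def indicator_def)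
  have "gabor_independent g M N"
  proof (rule gabor_independentI)
    fix a L and d :: "nat \<Rightarrow> nat \<Rightarrow> complex" and k m
    assume zero: "\<And>j. (\<Sum>k<L. \<Sum>m<M. d k m * gabor g M N (a + int k, m) j) = 0"
    show "k < L \<Longrightarrow> m < M \<Longrightarrow> d k m = 0"
    proof (induction k arbitrary: m rule: less_induct)
      case (less k)
      \<comment> \<open>At the points \<open>(a + int k) * int N + int r\<close> the modulation
        splits into a power of a root of unity and a phase independent of \<open>r\<close>. The
        phase is absorbed in \<open>e\<close>; being nonzero, it does not affect vanishing.\<close>
      define e where
        "e m = d k m * exp (2 * of_real pi * \<i> * of_int ((a + int k) * int N) * of_real (real m / real M))" for m
      have "(\<Sum>m<M. e m * cis (2 * pi * real r / real M) ^ m) = 0" if r: "r < M" for r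
      proof -
        \<comment> \<open>As \<open>r < M \<le> K\<close>, this point lies in the support of
          translate \<open>k\<close>; as \<open>r < M \<le> N\<close>, it lies to the left of all
          later translates. Earlier ones have zero coefficients by induction.\<close>
        let ?j = "(a + int k) * int N + int r"
        have other: "(\<Sum>m<M. d k' m * gabor g M N (a + int k', m) ?j) = 0"
          if k': "k' < L" "k' \<noteq> k" for k'
        proof (cases "k' < k")
          case True
          then show ?thesis using less k' by simp
        next
          case False
          then have "int (Suc k) * int N \<le> int k' * int N"
            using k' by (intro mult_right_mono) auto
          then have "?j - (a + int k') * int N < 0"
            using r assms(1) by (simp add: algebra_simps)
          then show ?thesis
            by (simp add: gabor_apply g_def)
        qed
        have "e m * cis (2 * pi * real r / real M) ^ m = d k m * gabor g M N (a + int k, m) ?j" for m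
        proof -
          have "cis (2 * pi * real r / real M) ^ m
              = exp (2 * of_real pi * \<i> * of_int (int r) * of_real (real m / real M))"
            unfolding cis_conv_exp exp_of_nat_mult[symmetric] by (simp add: field_simps)
          moreover have "g (?j - (a + int k) * int N) = 1"
            using r assms(2) by (simp add: g_def)
          ultimately show ?thesis
            unfolding e_def gabor_apply
            by (simp add: ring_distribs add_divide_distrib exp_add)
        qed
        then have "(\<Sum>m<M. e m * cis (2 * pi * real r / real M) ^ m)
            = (\<Sum>m<M. d k m * gabor g M N (a + int k, m) ?j)"
          by simp
        also have "\<dots> = (\<Sum>k'\<in>{k}. \<Sum>m<M. d k' m * gabor g M N (a + int k', m) ?j)"
          by simp
        also have "\<dots> = (\<Sum>k'<L. \<Sum>m<M. d k' m * gabor g M N (a + int k', m) ?j)"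
          using less.prems(1) other by (intro sum.mono_neutral_left) auto
        also have "\<dots> = 0"
          by (rule zero)
        finally show ?thesis .
      qed
      then have "e m = 0"
        using less.prems(2) by (rule discrete_Fourier_matrix_inj)
      then show ?case
        by (simp add: e_def)
    qed
  qed
  moreover have "finite (supp g)" "card (supp g) = K"
    by (simp_all add: supp)
  ultimately show ?thesis by blast
qed

section \<open>Injectivity of shift polynomials and the case \<open>M = 1\<close>\<close>

definition vanishing_progressions :: "nat \<Rightarrow> (int \<Rightarrow> complex) \<Rightarrow> bool" where
  "vanishing_progressions N g \<longleftrightarrow>
     (\<forall>j. (\<lambda>k. g (j + int k * int N)) \<longlonglongrightarrow> 0 \<and> (\<lambda>k. g (j - int k * int N)) \<longlonglongrightarrow> 0)"

text \<open>Square-summability enters only through this consequence, which passes to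
  \<open>g (j - int N) - \<mu> * g j\<close> by limit arithmetic alone.\<close>

lemma vanishing_progressions_ell2_Z:
  assumes "g \<in> ell2_Z" "N \<ge> 1"
  shows "vanishing_progressions N g"
proof -
  have lim: "(\<lambda>k. g (h k)) \<longlonglongrightarrow> 0" if "inj h" for h :: "nat \<Rightarrow> int"
  proof -
    have "(\<lambda>j. (cmod (g j))\<^sup>2) summable_on range h"
      using assms(1) unfolding ell2_Z_def by (auto intro: summable_on_subset_banach)
    then have "(\<lambda>k. (cmod (g (h k)))\<^sup>2) summable_on UNIV"
      using summable_on_reindex[OF that, of "\<lambda>j. (cmod (g j))\<^sup>2"] by (simp add: o_def)
    then have "(\<lambda>k. (cmod (g (h k)))\<^sup>2) \<longlonglongrightarrow> 0"
      by (intro summable_LIMSEQ_zero summable_on_imp_summable)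
    then have "(\<lambda>k. sqrt ((cmod (g (h k)))\<^sup>2)) \<longlonglongrightarrow> sqrt 0"
      by (rule tendsto_real_sqrt)
    then show ?thesis
      by (simp add: tendsto_norm_zero_iff)
  qed
  show ?thesis
    unfolding vanishing_progressions_def
    using assms(2) by (intro allI conjI lim) (auto simp: inj_def)
qed

text \<open>The modulus of \<open>g\<close> does not decrease along steps of \<open>N\<close> to the
  right if \<open>cmod \<mu> \<le> 1\<close>, and to the left otherwise. Either way
  \<open>cmod (g j)\<close> is bounded by a null sequence.\<close>

lemma shift_eigenvector_eq_0:
  assumes "vanishing_progressions N g" "\<And>j. g (j - int N) = \<mu> * g j"
  shows "g j = 0"
proof -
  have pow: "g (j - int k * int N) = \<mu> ^ k * g j" for j k
  proof (induction k)
    case (Suc k)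
    then show ?case
      using assms(2)[of "j - int k * int N"] by (simp add: algebra_simps)
  qed simp
  have lim: "(\<lambda>k. cmod (g (j + int k * int N))) \<longlonglongrightarrow> 0" "(\<lambda>k. cmod (g (j - int k * int N))) \<longlonglongrightarrow> 0"
    using assms(1) unfolding vanishing_progressions_def by (auto intro: tendsto_norm_zero)
  have "cmod (g j) \<le> 0"
  proof (cases "cmod \<mu> \<le> 1")
    case True
    have "cmod (g j) \<le> cmod (g (j + int k * int N))" for k
    proof -
      have "cmod (g j) = cmod \<mu> ^ k * cmod (g (j + int k * int N))"
        using pow[of "j + int k * int N" k] by (simp add: norm_mult norm_power)
      also have "\<dots> \<le> 1 * cmod (g (j + int k * int N))"
        using True by (intro mult_right_mono power_le_one) auto
      finally show ?thesis by simp
    qed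
    then show ?thesis
      using lim(1) by (intro LIMSEQ_le_const) auto
  next
    case False
    have "cmod (g j) \<le> cmod (g (j - int k * int N))" for k
    proof -
      have "1 * cmod (g j) \<le> cmod \<mu> ^ k * cmod (g j)"
        using False by (intro mult_right_mono one_le_power) auto
      then show ?thesis
        by (simp add: pow norm_mult norm_power)
    qed
    then show ?thesis
      using lim(2) by (intro LIMSEQ_le_const) auto
  qed
  then show ?thesis by simp
qed

text \<open>With \<open>p = (X - \<mu>) q\<close> and \<open>h = (S - \<mu>) g\<close>, where
  \<open>S\<close> is translation by \<open>N\<close>, the relation becomes
  \<open>q(S) h = 0\<close>. Induction gives \<open>h = 0\<close>, so \<open>g\<close> is an
  eigenvector of \<open>S\<close>. The induction must vary \<open>g\<close>, being applied to
  \<open>h\<close>.\<close>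

lemma shift_polynomial_inj:
  assumes "p \<noteq> 0" "degree p \<le> n" "vanishing_progressions N g"
    and "\<And>j. (\<Sum>i\<le>n. coeff p i * g (j - int i * int N)) = 0"
  shows "g j = 0"
  using assms
proof (induction n arbitrary: p g j)
  case 0
  then show ?case
    using leading_coeff_0_iff[of p] 0(4)[of j] by simp
next
  case (Suc n)
  show ?case
  proof (cases "degree p = 0")
    case True
    have "(\<Sum>i\<le>Suc n. coeff p i * g (j - int i * int N)) = coeff p 0 * g j"
      using True by (simp add: sum.atMost_Suc_shift coeff_eq_0 del: sum.atMost_Suc)
    then show ?thesis
      using Suc.prems(1,4) True by (metis leading_coeff_0_iff mult_eq_0_iff)
  next
    case False
    then obtain \<mu> where "poly p \<mu> = 0"
      using fundamental_theorem_of_algebra constant_degree by metis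
    then obtain q where q: "p = [:- \<mu>, 1:] * q"
      unfolding poly_eq_0_iff_dvd by (elim dvdE)
    have "q \<noteq> 0"
      using q Suc.prems(1) by auto
    then have deg: "degree q \<le> n"
      using q Suc.prems(2) by (simp add: degree_mult_eq del: mult_pCons_left)
    define h where "h j = g (j - int N) - \<mu> * g j" for j
    \<comment> \<open>In this form multiplication by \<open>X\<close> is an index shift of the
      coefficients, matching the additional translation by \<open>N\<close>.\<close>
    have p: "p = pCons 0 q - smult \<mu> q"
      by (simp add: q)
    have "h j = 0" for j
    proof (rule Suc.IH[OF \<open>q \<noteq> 0\<close> deg])
      show "vanishing_progressions N h"
        unfolding vanishing_progressions_def
      proof (intro allI conjI)
        fix j
        have lim: "(\<lambda>k. g (i + int k * int N)) \<longlonglongrightarrow> 0" "(\<lambda>k. g (i - int k * int N)) \<longlonglongrightarrow> 0" for i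
          using Suc.prems(3) unfolding vanishing_progressions_def by auto
        have "(\<lambda>k. g (j - int N + int k * int N) - \<mu> * g (j + int k * int N)) \<longlonglongrightarrow> 0 - \<mu> * 0"
          by (intro tendsto_intros lim)
        then show "(\<lambda>k. h (j + int k * int N)) \<longlonglongrightarrow> 0"
          by (simp add: h_def algebra_simps)
        have "(\<lambda>k. g (j - int N - int k * int N) - \<mu> * g (j - int k * int N)) \<longlonglongrightarrow> 0 - \<mu> * 0"
          by (intro tendsto_intros lim)
        then show "(\<lambda>k. h (j - int k * int N)) \<longlonglongrightarrow> 0"
          by (simp add: h_def algebra_simps)
      qed
    next
      fix j
      have top: "coeff q (Suc n) = 0"
        using deg by (intro coeff_eq_0) simp
      have "(\<Sum>i\<le>n. coeff q i * h (j - int i * int N))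
          = (\<Sum>i\<le>n. coeff q i * g (j - int (Suc i) * int N)) - \<mu> * (\<Sum>i\<le>n. coeff q i * g (j - int i * int N))"
        by (simp add: h_def sum_subtractf sum_distrib_left algebra_simps)
      also have "(\<Sum>i\<le>n. coeff q i * g (j - int (Suc i) * int N))
          = (\<Sum>i\<le>Suc n. coeff (pCons 0 q) i * g (j - int i * int N))"
        by (subst sum.atMost_Suc_shift) simp
      also have "(\<Sum>i\<le>n. coeff q i * g (j - int i * int N)) = (\<Sum>i\<le>Suc n. coeff q i * g (j - int i * int N))"
        by (simp add: top)
      also have "(\<Sum>i\<le>Suc n. coeff (pCons 0 q) i * g (j - int i * int N))
          - \<mu> * (\<Sum>i\<le>Suc n. coeff q i * g (j - int i * int N))
          = (\<Sum>i\<le>Suc n. coeff p i * g (j - int i * int N))"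
        unfolding p by (simp only: coeff_diff coeff_smult sum_distrib_left left_diff_distrib sum_subtractf mult.assoc)
      finally show "(\<Sum>i\<le>n. coeff q i * h (j - int i * int N)) = 0"
        using Suc.prems(4) by simp
    qed
    then have "g (j - int N) = \<mu> * g j" for j
      by (simp add: h_def)
    with Suc.prems(3) show ?thesis
      by (rule shift_eigenvector_eq_0)
  qed
qed

lemma gabor_independent_single_modulation:
  assumes "g \<in> ell2_Z" "g \<noteq> (\<lambda>j. 0)" "N \<ge> 1"
  shows "gabor_independent g 1 N"
proof (rule gabor_independentI)
  fix a L and d :: "nat \<Rightarrow> nat \<Rightarrow> complex" and k m :: nat
  assume zero: "\<And>j. (\<Sum>k<L. \<Sum>m<1. d k m * gabor g 1 N (a + int k, m) j) = 0"
    and k: "k < L" and m: "m < 1"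
  define p where "p = (\<Sum>k<L. monom (d k 0) k)"
  have coeff: "coeff p i = (if i < L then d i 0 else 0)" for i
    by (simp add: p_def coeff_sum)
  have deg: "degree p \<le> L"
    by (rule degree_le) (simp add: coeff)
  have "(\<Sum>i\<le>L. coeff p i * g (j - int i * int N)) = 0" for j
  proof -
    have "(\<Sum>i\<le>L. coeff p i * g (j - int i * int N)) = (\<Sum>i<L. d i 0 * g (j - int i * int N))"
      by (intro sum.mono_neutral_cong_right) (auto simp: coeff)
    also have "\<dots> = 0"
      \<comment> \<open>Evaluating at \<open>j + a * int N\<close> removes the offset
        \<open>a\<close>; the only modulation, \<open>m = 0\<close>, is the identity.\<close>
      using zero[of "j + a * int N"] by (simp add: gabor_apply algebra_simps)
    finally show ?thesis .
  qed
  then have "p = 0"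
    using shift_polynomial_inj[OF _ deg vanishing_progressions_ell2_Z[OF assms(1,3)]] assms(2) by blast
  then show "d k m = 0"
    using coeff[of k] k m by simp
qed

theorem theorem2p3:
  fixes M N :: nat
  assumes "M \<ge> 1" and "N \<ge> 1"
  shows "(M = 1 \<longrightarrow> (\<forall>g \<in> ell2_Z - {\<lambda>j. 0}. gabor_independent g M N)) \<and>
    (\<forall>g \<in> ell2_Z. finite (supp g) \<longrightarrow> M > card (supp g) \<longrightarrow> gabor_dependent g M N) \<and>
    (N < M \<longrightarrow> (\<forall>g \<in> ell2_Z. finite (supp g) \<longrightarrow> gabor_dependent g M N)) \<and>
    (\<forall>M' N' K :: nat. M' \<ge> 2 \<longrightarrow> N' \<ge> 1 \<longrightarrow> K \<ge> 1 \<longrightarrow>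
      (\<exists>g \<in> ell2_Z. finite (supp g) \<and> card (supp g) = K \<and> gabor_dependent g M' N')) \<and>
    (N \<ge> M \<longrightarrow> (\<forall>K :: nat. K \<ge> 1 \<longrightarrow> K \<ge> M \<longrightarrow>
      (\<exists>g \<in> ell2_Z. finite (supp g) \<and> card (supp g) = K \<and> gabor_independent g M N)))"
proof (intro conjI impI ballI allI)
  fix g assume "M = 1" "g \<in> ell2_Z - {\<lambda>j. 0}"
  then show "gabor_independent g M N"
    using assms(2) gabor_independent_single_modulation by simp
next
  fix g assume "finite (supp g)" "M > card (supp g)"
  then show "gabor_dependent g M N"
    by (rule gabor_dependent_card_supp_less)
next
  fix g assume "N < M" "finite (supp g)"
  then show "gabor_dependent g M N"
    by (intro gabor_dependent_oversampled)
next
  fix M' N' K :: nat assume "M' \<ge> 2"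
  then show "\<exists>g\<in>ell2_Z. finite (supp g) \<and> card (supp g) = K \<and> gabor_dependent g M' N'"
    using exists_gabor_dependent[of M' K N'] finite_supp_in_ell2_Z by blast
next
  fix K :: nat assume "N \<ge> M" "K \<ge> M"
  then show "\<exists>g\<in>ell2_Z. finite (supp g) \<and> card (supp g) = K \<and> gabor_independent g M N"
    using exists_gabor_independent[of M N K] finite_supp_in_ell2_Z by blast
qed

end
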